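(* For $\alpha\ge 0$, $\beta,\theta>0$ let $K_{\alpha,\beta,\theta}$ be the distribution function $$K_{\alpha,\beta,\theta}(x)=1-\frac{1}{\left(\frac{x}{\beta}+\alpha^\theta\right)^{1/\theta}+1-\alpha},\qquad x\ge 0.$$ Let $\alpha,\alpha_1\ge 0$ and $\beta,\theta,\beta_1,\theta_1>0$ satisfy one of the following: (ST1) $\theta<\theta_1$, $\alpha^{\theta-1}\beta\theta<\alpha_1^{\theta_1-1}\beta_1\theta_1$, and $\alpha_1(1-\theta)-\alpha(1-\theta_1)\ge 0$; (ST2) $\theta=\theta_1$, $\beta<\beta_1$, $\alpha^{\theta-1}\beta<\alpha_1^{\theta_1-1}\beta_1$, and $(1-\theta)\left(\alpha_1^\theta\beta_1-\alpha^\theta\beta\right)>0$. Then $K_{\alpha,\beta,\theta}\leq_{st}K_{\alpha_1,\beta_1,\theta_1}$.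
   Context: $F_1\leq_{st}F_2$ (usual stochastic order) means $1-F_1(x)\le 1-F_2(x)$ for every $x\in\mathbb{R}$. All $K_{\alpha,\beta,\theta}$ vanish on $(-\infty,0]$. A power $0^{\gamma}$ is read as $+\infty$ when $\gamma<0$, and $0^0=1$. *)

theory Defs
  imports Complex_Main "HOL-Library.Extended_Real"
begin

text \<open>The exponents \<open>\<theta>\<close> and \<open>1 / \<theta>\<close> are positive and the bases nonnegative for \<open>x \<ge> 0\<close>,
  so \<open>powr\<close> (with \<open>0 powr c = 0\<close>) is the ordinary real power here.\<close>

definition K :: "real \<Rightarrow> real \<Rightarrow> real \<Rightarrow> real \<Rightarrow> real" where
  "K \<alpha> \<beta> \<theta> x =
     (if x < 0 then 0
      else 1 - 1 / ((x / \<beta> + \<alpha> powr \<theta>) powr (1 / \<theta>) + 1 - \<alpha>))"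

lemma K_nonpos:
  assumes "\<alpha> \<ge> 0" "\<beta> > 0" "\<theta> > 0" "x \<le> 0"
  shows "K \<alpha> \<beta> \<theta> x = 0"
  using assms by (auto simp: K_def powr_powr)

definition st_le :: "(real \<Rightarrow> real) \<Rightarrow> (real \<Rightarrow> real) \<Rightarrow> bool"  (infix "\<le>\<^sub>s\<^sub>t" 50) where
  "F1 \<le>\<^sub>s\<^sub>t F2 \<longleftrightarrow> (\<forall>x. 1 - F1 x \<le> 1 - F2 x)"

text \<open>The power \<open>a\<^sup>c\<close> of a nonnegative base with the conventions \<open>0\<^sup>c = \<infinity>\<close> for \<open>c < 0\<close> and
  \<open>0\<^sup>0 = 1\<close>; \<open>powr\<close> would give 0 in both cases.\<close>

definition epowr :: "real \<Rightarrow> real \<Rightarrow> ereal" where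
  "epowr a c =
     (if a = 0 then (if c < 0 then \<infinity> else if c = 0 then 1 else 0)
      else ereal (a powr c))"

end

theory Submission imports Defs begin

text \<open>Writing \<open>K = 1 - 1 / (1 + h)\<close>, the function \<open>h\<close> is the inverse of
  \<open>H y = \<beta> ((y + \<alpha>)\<^sup>\<theta> - \<alpha>\<^sup>\<theta>)\<close> on the half-line \<open>y \<ge> 0\<close>, so the claim amounts to
  \<open>H \<le> H\<^sub>1\<close>. Since both vanish at 0, it suffices to compare the derivatives
  \<open>\<beta> \<theta> (y + \<alpha>)\<^bsup>\<theta> - 1\<^esup>\<close>. Their ratio has logarithmic derivative of the sign of
  \<open>(\<theta>\<^sub>1 - \<theta>) y + \<alpha>\<^sub>1 (1 - \<theta>) - \<alpha> (1 - \<theta>\<^sub>1)\<close>. Under (ST1) this is nonnegative, so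
  the comparison at \<open>y = 0\<close> propagates. Under (ST2) the ratio is monotone, so it is at least the
  smaller of its value at 0 and its limit \<open>\<beta>\<^sub>1 / \<beta>\<close>, both of which exceed 1.\<close>

text \<open>Since \<open>0 * ln 0 = 0\<close>, the expression \<open>exp (c * ln a)\<close> respects \<open>0\<^sup>0 = 1\<close>, unlike \<open>powr\<close>.\<close>

lemma epowr_eq_exp:
  assumes "a \<ge> 0" "a > 0 \<or> c = 0"
  shows "epowr a c = ereal (exp (c * ln a))"
  using assms by (auto simp: epowr_def powr_def one_ereal_def)

lemma continuous_on_mult_ln:
  fixes a c :: real
  assumes "a \<ge> 0" "a > 0 \<or> c = 0"
  shows "continuous_on {0..y} (\<lambda>t. c * ln (t + a))"
proof (cases "c = 0")
  case False
  with assms show ?thesis by (intro continuous_intros) auto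
qed simp

text \<open>The log-ratio \<open>f\<close> has a derivative with numerator
  \<open>(c1 - c) * t + (c1 * a - c * a1)\<close>, which is nonnegative, so the inequality at 0
  persists. Requiring a positive shift or a zero exponent keeps \<open>f\<close> continuous at
  0.\<close>

lemma powr_compare_from_zero:
  fixes a a1 c c1 B B1 y :: real
  assumes "a \<ge> 0" "a1 \<ge> 0" and a: "a > 0 \<or> c = 0" and a1: "a1 > 0 \<or> c1 = 0"
    and "c \<le> c1" and "c * a1 \<le> c1 * a"
    and start: "B * exp (c * ln a) \<le> B1 * exp (c1 * ln a1)"
    and "y > 0" "B \<ge> 0"
  shows "B * (y + a) powr c \<le> B1 * (y + a1) powr c1"
proof -
  define f where "f t = c1 * ln (t + a1) - c * ln (t + a)" for t
  have "f 0 \<le> f y"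
  proof (rule DERIV_nonneg_imp_increasing_open[where f = f])
    show "0 \<le> y" using assms by simp
    show "continuous_on {0..y} f"
      unfolding f_def using assms by (intro continuous_on_diff continuous_on_mult_ln)
  next
    fix t :: real
    assume t: "0 < t" "t < y"
    have pos: "t + a > 0" "t + a1 > 0" using t assms by auto
    have "(f has_real_derivative (c1 / (t + a1) - c / (t + a))) (at t)"
      unfolding f_def using pos by (auto intro!: derivative_eq_intros)
    moreover have "c * (t + a1) \<le> c1 * (t + a)"
      unfolding distrib_left using t assms by (intro add_mono mult_right_mono) auto
    then have "c / (t + a) \<le> c1 / (t + a1)"
      using pos by (simp add: field_simps)
    then have "c1 / (t + a1) - c / (t + a) \<ge> 0" by simp
    ultimately show "\<exists>d. (f has_real_derivative d) (at t) \<and> d \<ge> 0" by blast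
  qed
  then have "exp (f 0) \<le> exp (f y)" by simp
  then have growth: "exp (c1 * ln a1) * exp (c * ln (y + a)) \<le> exp (c1 * ln (y + a1)) * exp (c * ln a)"
    by (simp add: f_def exp_diff field_simps)
  have "B * exp (c * ln (y + a)) * exp (c * ln a) \<le> B1 * exp (c1 * ln a1) * exp (c * ln (y + a))"
    using mult_right_mono[OF start, of "exp (c * ln (y + a))"] by (simp add: mult_ac)
  also have "\<dots> \<le> B1 * exp (c1 * ln (y + a1)) * exp (c * ln a)"
  proof -
    have "0 \<le> B1 * exp (c1 * ln a1)"
      using start \<open>B \<ge> 0\<close> by (meson exp_ge_zero mult_nonneg_nonneg order_trans)
    then have "B1 \<ge> 0" by (simp add: zero_le_mult_iff)
    from mult_left_mono[OF growth this] show ?thesis by (simp add: mult_ac)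
  qed
  finally have "B * exp (c * ln (y + a)) \<le> B1 * exp (c1 * ln (y + a1))" by simp
  \<comment> \<open>Here \<open>y > 0\<close> makes both bases positive, so \<open>powr\<close>
    agrees with the exponential form.\<close>
  then show ?thesis using assms by (simp add: powr_def)
qed

lemma st_le_K_of_density_le:
  fixes a a1 b b1 p p1 :: real
  assumes "a \<ge> 0" "a1 \<ge> 0" "b > 0" "b1 > 0" "p > 0" "p1 > 0"
    and density: "\<And>y. y > 0 \<Longrightarrow> b * p * (y + a) powr (p - 1) \<le> b1 * p1 * (y + a1) powr (p1 - 1)"
  shows "K a b p \<le>\<^sub>s\<^sub>t K a1 b1 p1"
proof -
  define H where "H y = b * ((y + a) powr p - a powr p)" for y
  define H1 where "H1 y = b1 * ((y + a1) powr p1 - a1 powr p1)" for y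
  \<comment> \<open>Continuity up to 0 lets derivatives on the open half-line suffice, even if a
    density blows up at 0.\<close>
  have H_le: "H y \<le> H1 y" if "y \<ge> 0" for y
  proof -
    have "H1 0 - H 0 \<le> H1 y - H y"
    proof (rule DERIV_nonneg_imp_increasing_open[where f = "\<lambda>t. H1 t - H t"])
      show "0 \<le> y" by fact
      show "continuous_on {0..y} (\<lambda>t. H1 t - H t)"
        unfolding H_def H1_def using assms
        by (intro continuous_intros continuous_on_powr') auto
    next
      fix t :: real
      assume t: "0 < t" "t < y"
      have pos: "t + a > 0" "t + a1 > 0" using t assms by auto
      have "((\<lambda>t. H1 t - H t) has_real_derivative
          (b1 * p1 * (t + a1) powr (p1 - 1) - b * p * (t + a) powr (p - 1))) (at t)"
        unfolding H_def H1_def using pos by (auto intro!: derivative_eq_intros)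
      with density[OF t(1)]
      show "\<exists>d. ((\<lambda>t. H1 t - H t) has_real_derivative d) (at t) \<and> d \<ge> 0" by force
    qed
    then show ?thesis using assms by (simp add: H_def H1_def)
  qed
  have "1 - K a b p x \<le> 1 - K a1 b1 p1 x" for x
  proof (cases "x < 0")
    case False
    \<comment> \<open>This is the preimage of \<open>x\<close> under \<open>H1\<close>; applying the
      inverse of \<open>H\<close> to \<open>H y \<le> x\<close> then bounds
      \<open>y\<close>.\<close>
    define y where "y = (x / b1 + a1 powr p1) powr (1 / p1) - a1"
    have "a1 = (a1 powr p1) powr (1 / p1)" using assms by (simp add: powr_powr)
    also have "\<dots> \<le> (x / b1 + a1 powr p1) powr (1 / p1)"
      using assms False by (intro powr_mono2) auto
    finally have y: "y \<ge> 0" by (simp add: y_def)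
    have "H1 y = x"
      using assms False by (simp add: H1_def y_def powr_powr)
    with H_le[OF y] have "b * ((y + a) powr p - a powr p) \<le> x" by (simp add: H_def)
    then have "(y + a) powr p \<le> x / b + a powr p"
      using assms by (simp add: field_simps)
    then have "((y + a) powr p) powr (1 / p) \<le> (x / b + a powr p) powr (1 / p)"
      using assms by (intro powr_mono2) auto
    then have "y + a \<le> (x / b + a powr p) powr (1 / p)"
      using assms y by (simp add: powr_powr)
    then have "1 / ((x / b + a powr p) powr (1 / p) + 1 - a) \<le> 1 / (y + 1)"
      using y by (intro divide_left_mono) auto
    moreover have "y + 1 = (x / b1 + a1 powr p1) powr (1 / p1) + 1 - a1"
      by (simp add: y_def)
    ultimately show ?thesis using False by (simp add: K_def)
  qed (simp add: K_def)
  then show ?thesis by (simp add: st_le_def)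
qed

text \<open>Once the infinite and zero values of \<open>epowr\<close> are excluded, the slope
  condition is exactly \<open>c * a1 \<le> c1 * a\<close> with \<open>c = p - 1\<close> and
  \<open>c1 = p1 - 1\<close>.\<close>

lemma density_le_ST1:
  fixes a a1 b b1 p p1 y :: real
  assumes "a \<ge> 0" "a1 \<ge> 0" "b > 0" "p > 0" "b1 > 0" "p1 > 0"
    and "p < p1"
    and start: "epowr a (p - 1) * ereal b * ereal p < epowr a1 (p1 - 1) * ereal b1 * ereal p1"
    and slope: "a1 * (1 - p) - a * (1 - p1) \<ge> 0"
    and "y > 0"
  shows "b * p * (y + a) powr (p - 1) \<le> b1 * p1 * (y + a1) powr (p1 - 1)"
proof -
  have lhs_inf: False if "a = 0" "p < 1"
    using start that assms by (auto simp: epowr_def)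
  have rhs_zero: False if "a1 = 0" "p1 > 1"
    using start that assms
    by (auto simp: epowr_def mult_less_0_iff split: if_splits)
  \<comment> \<open>If \<open>a = 0\<close> and \<open>p > 1\<close>, the slope condition forces
    \<open>a1 = 0\<close>, so the right side of \<open>start\<close> would vanish.\<close>
  have a: "a > 0 \<or> p - 1 = 0"
  proof (rule ccontr)
    assume "\<not> ?thesis"
    with \<open>a \<ge> 0\<close> have "a = 0" "p \<noteq> 1" by auto
    with lhs_inf have "p > 1" by force
    then have "a1 = 0"
      using slope \<open>a = 0\<close> \<open>a1 \<ge> 0\<close> by (simp add: zero_le_mult_iff)
    with rhs_zero \<open>p > 1\<close> \<open>p < p1\<close> show False by simp
  qed
  have a1: "a1 > 0 \<or> p1 - 1 = 0"
  proof (rule ccontr)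
    assume "\<not> ?thesis"
    with \<open>a1 \<ge> 0\<close> have "a1 = 0" "p1 \<noteq> 1" by auto
    with rhs_zero have "p1 < 1" by force
    then have "a = 0"
      using slope \<open>a1 = 0\<close> \<open>a \<ge> 0\<close> by (simp add: mult_le_0_iff)
    with lhs_inf \<open>p1 < 1\<close> \<open>p < p1\<close> show False by simp
  qed
  have "b * p * exp ((p - 1) * ln a) < b1 * p1 * exp ((p1 - 1) * ln a1)"
    using start unfolding epowr_eq_exp[OF \<open>a \<ge> 0\<close> a] epowr_eq_exp[OF \<open>a1 \<ge> 0\<close> a1]
    by (simp add: mult_ac)
  with a a1 assms show ?thesis
    by (intro powr_compare_from_zero) (auto simp: algebra_simps)
qed

lemma density_le_ST2:
  fixes a a1 b b1 p y :: real
  assumes "a \<ge> 0" "a1 \<ge> 0" "b > 0" "p > 0" "b1 > 0"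
    and "b < b1"
    and start: "epowr a (p - 1) * ereal b < epowr a1 (p - 1) * ereal b1"
    and sgn: "(1 - p) * (a1 powr p * b1 - a powr p * b) > 0"
    and "y > 0"
  shows "b * p * (y + a) powr (p - 1) \<le> b1 * p * (y + a1) powr (p - 1)"
proof -
  \<comment> \<open>For \<open>p < 1\<close>, finiteness of the left side of \<open>start\<close>
    gives \<open>a > 0\<close>, and \<open>sgn\<close> passes this to \<open>a1\<close>. For
    \<open>p > 1\<close>, \<open>sgn\<close> gives \<open>a > 0\<close> and \<open>start\<close>
    passes it on. The value \<open>p = 1\<close> contradicts \<open>sgn\<close>.\<close>
  have "a > 0 \<and> a1 > 0"
  proof (cases "p < 1")
    case True
    with start \<open>b > 0\<close> \<open>a \<ge> 0\<close> have "a > 0" by (auto simp: epowr_def split: if_splits)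
    moreover have "a1 powr p * b1 > a powr p * b"
      using sgn True by (simp add: zero_less_mult_iff)
    ultimately show ?thesis using \<open>a1 \<ge> 0\<close> \<open>b > 0\<close>
      by (cases "a1 = 0") (auto simp: mult_less_0_iff)
  next
    case False
    with sgn have "p > 1" and less: "a1 powr p * b1 < a powr p * b"
      by (auto simp: zero_less_mult_iff)
    have "0 \<le> a1 powr p * b1" using \<open>b1 > 0\<close> by simp
    with less have "a \<noteq> 0" by auto
    moreover have "a1 \<noteq> 0"
      using start \<open>p > 1\<close> \<open>b > 0\<close> \<open>a \<noteq> 0\<close> by (auto simp: epowr_def mult_less_0_iff)
    ultimately show ?thesis using \<open>a \<ge> 0\<close> \<open>a1 \<ge> 0\<close> by simp
  qed
  then have pos: "a > 0" "a1 > 0" by auto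
  have "b * (y + a) powr (p - 1) \<le> b1 * (y + a1) powr (p - 1)"
  proof (cases "(p - 1) * a1 \<le> (p - 1) * a")
    case True
    have "b * exp ((p - 1) * ln a) < b1 * exp ((p - 1) * ln a1)"
      using start pos by (simp add: epowr_eq_exp mult_ac)
    with True pos assms show ?thesis
      by (intro powr_compare_from_zero) auto
  next
    case False
    \<comment> \<open>Here the density ratio decreases towards \<open>b1 / b\<close>; the powers
      alone are already ordered, and \<open>b < b1\<close> does the rest.\<close>
    have "(y + a) powr (p - 1) \<le> (y + a1) powr (p - 1)"
    proof (cases "p \<ge> 1")
      case True
      with False have "a \<le> a1" by (meson diff_ge_0_iff_ge linear mult_left_mono)
      then show ?thesis using True pos \<open>y > 0\<close> by (intro powr_mono2) auto
    next
      case p: False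
      with False have "a1 \<le> a" by (simp add: mult_le_cancel_left)
      then show ?thesis using p pos \<open>y > 0\<close> by (intro powr_mono2') auto
    qed
    then show ?thesis using assms by (intro mult_mono) auto
  qed
  from mult_left_mono[OF this, of p] \<open>p > 0\<close> show ?thesis by (simp add: mult_ac)
qed

theorem theorem5p3:
  fixes \<alpha> \<beta> \<theta> \<alpha>1 \<beta>1 \<theta>1 :: real
  assumes "\<alpha> \<ge> 0" and "\<alpha>1 \<ge> 0"
    and "\<beta> > 0" and "\<theta> > 0" and "\<beta>1 > 0" and "\<theta>1 > 0"
    and "(\<theta> < \<theta>1
          \<and> epowr \<alpha> (\<theta> - 1) * ereal \<beta> * ereal \<theta> < epowr \<alpha>1 (\<theta>1 - 1) * ereal \<beta>1 * ereal \<theta>1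
          \<and> \<alpha>1 * (1 - \<theta>) - \<alpha> * (1 - \<theta>1) \<ge> 0)
       \<or> (\<theta> = \<theta>1 \<and> \<beta> < \<beta>1
          \<and> epowr \<alpha> (\<theta> - 1) * ereal \<beta> < epowr \<alpha>1 (\<theta>1 - 1) * ereal \<beta>1
          \<and> (1 - \<theta>) * (\<alpha>1 powr \<theta> * \<beta>1 - \<alpha> powr \<theta> * \<beta>) > 0)"
  shows "K \<alpha> \<beta> \<theta> \<le>\<^sub>s\<^sub>t K \<alpha>1 \<beta>1 \<theta>1"
  using assms density_le_ST1[of \<alpha> \<alpha>1 \<beta> \<theta> \<beta>1 \<theta>1] density_le_ST2[of \<alpha> \<alpha>1 \<beta> \<theta> \<beta>1]
  by (intro st_le_K_of_density_le) auto

end
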